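(* Consider a single ship with capacity $C$ (tonnes) and sailing speed $e$, and assume: (A1) (Emission rates) The carbon emission rate per nautical mile is higher when the ship is laden than when it is in ballast: $\epsilon_{\text{laden}}>\epsilon_{\text{ballast}}>0$. The emission rate per unit time at port is $\epsilon_{\text{port}}\ge 0$. (A2) (Port versus ballast emission intensity) The emission intensity of ballast sailing is greater than that of port stay when measured per unit of CII-accounted activity: $\epsilon_{\text{ballast}}>\epsilon_{\text{port}}/e$. (A3) (Fixed laden task) The total laden distance $D^T_{\text{laden}}$ and its associated emissions $M_{\text{laden}}$ are fixed. The ship is initially compliant with the baseline CII standard, meaning that it operates at the lowest sailing speed during both laden and ballast voyages. (A4) (Feasible standard) The CII standard is feasible, i.e. it is not stricter than the lowest achievable intensity of continuous ballast sailing: $C\cdot\mathrm{CII}_{\text{target}}\ge\epsilon_{\text{ballast}}$, where $\mathrm{CII}_{\text{target}}$ is the standard to be met. Under (A1)–(A4), if the ship is initially compliant with a Supply-based CII standard $\mathrm{CII}_0$ and the standard is tightened to $(1-p)\,\mathrm{CII}_0$ for some $p\in(0,1)$ (so that $\mathrm{CII}_{\text{target}}=(1-p)\,\mathrm{CII}_0$), then the ship can achieve compliance with the new standard by replacing port time with additional ballast sailing, but this strategy results in an increase in its total annual CO2 emissions.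
   Context: The Supply-based Carbon Intensity Indicator (CII) of a ship is $\mathrm{CII}=\dfrac{M}{C\cdot D^T}$, where $M$ is its annual CO2 emissions (grams), $C$ is its capacity measure (tonnes), and $D^T$ is its total annual distance (nautical miles). A CII standard is an upper threshold for this annual indicator, and a ship is compliant with a standard if its CII does not exceed it. "Laden" means sailing with cargo and "ballast" means sailing without cargo; $\epsilon_{\text{laden}}$ and $\epsilon_{\text{ballast}}$ are the emission rates per nautical mile in these two states, and $\epsilon_{\text{port}}$ is the emission rate per unit time while staying at port. Ballast sailing adds to both the ship's emissions and its total distance. Replacing port time with additional ballast sailing means increasing the annual ballast distance, with the extra sailing time (distance divided by $e$) offset by an equal reduction of time at port, the laden task being unchanged.
   Formalization: The case of zero port emission rate together with equality in (A4) is excluded, since the claim fails there for any positive laden distance; and port time is shown to stay nonnegative only when the ship has enough port time to reach the break-even ballast distance. *)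

theory Defs
  imports Complex_Main
begin

text \<open>
  Units: capacity in tonnes, distances in nautical miles, speeds in nautical miles per unit of time,
  emissions in grams.  The sailing emission rates are per nautical mile and depend on the sailing
  speed; the port emission rate is per unit of time.  The field \<open>speeds\<close> is the set of
  speeds at which the ship can sail.
\<close>

record ship =
  capacity :: real
  speeds :: "real set"
  laden_rate :: "real \<Rightarrow> real"
  ballast_rate :: "real \<Rightarrow> real"
  port_rate :: real

text \<open>One year of operation of a ship.\<close>

record operation =
  laden_distance :: real
  laden_speed :: real
  ballast_distance :: real
  ballast_speed :: real
  port_time :: real

definition total_distance :: "operation \<Rightarrow> real" where
  "total_distance y = laden_distance y + ballast_distance y"

definition laden_emissions :: "ship \<Rightarrow> operation \<Rightarrow> real" where
  "laden_emissions s y = laden_rate s (laden_speed y) * laden_distance y"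

definition emissions :: "ship \<Rightarrow> operation \<Rightarrow> real" where
  "emissions s y =
     laden_emissions s y
     + ballast_rate s (ballast_speed y) * ballast_distance y
     + port_rate s * port_time y"

definition CII :: "ship \<Rightarrow> operation \<Rightarrow> real" where
  "CII s y = emissions s y / (capacity s * total_distance y)"

definition compliant :: "ship \<Rightarrow> real \<Rightarrow> operation \<Rightarrow> bool" where
  "compliant s std y \<longleftrightarrow> CII s y \<le> std"

text \<open>
  Replacing port time by \<open>d\<close> additional nautical miles in ballast.  The laden task, the speeds and
  the total length of the year are unchanged.  The result is a physically possible year only if
  the remaining port time is nonnegative; this is not built into the operation.
\<close>

definition replace_port_by_ballast :: "real \<Rightarrow> operation \<Rightarrow> operation" where
  "replace_port_by_ballast d y =
     y\<lparr>ballast_distance := ballast_distance y + d,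
       port_time := port_time y - d / ballast_speed y\<rparr>"

text \<open>
  The solution \<open>d\<close> of the linear equation
  \<open>emissions + d * (ballast rate - port rate / speed) = capacity * std * (total distance + d)\<close>,
  that is, the additional ballast distance at which the indicator equals \<open>std\<close>.
  It is negative if the indicator is below \<open>std\<close> already.
\<close>

definition break_even_distance :: "ship \<Rightarrow> real \<Rightarrow> operation \<Rightarrow> real" where
  "break_even_distance s std y =
     (emissions s y - capacity s * std * total_distance y)
     / (capacity s * std - (ballast_rate s (ballast_speed y) - port_rate s / ballast_speed y))"

definition enough_port_time :: "ship \<Rightarrow> real \<Rightarrow> operation \<Rightarrow> bool" where
  "enough_port_time s std y \<longleftrightarrow>
     0 < port_time y \<and> break_even_distance s std y / ballast_speed y \<le> port_time y"

end

theory Submission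
  imports Defs
begin

text \<open>Each extra ballast mile adds one mile of distance and net emissions r, the ballast rate
  minus \<open>port_rate s / e\<close> saved at port. The new CII is thus the average of the old CII
  and r / \<open>capacity s\<close>, weighted by the old distance and the added distance d. Since r
  lies strictly below \<open>capacity s * CII_target\<close>, a large enough d brings the CII down
  to the target; \<open>compliant_replace_port_by_ballast_iff\<close> gives the exact threshold.
  Since A2 makes r positive, every such replacement raises emissions.\<close>

lemma emissions_replace_port_by_ballast:
  "emissions s (replace_port_by_ballast d y) =
     emissions s y + d * (ballast_rate s (ballast_speed y) - port_rate s / ballast_speed y)"
  by (simp add: emissions_def laden_emissions_def replace_port_by_ballast_def algebra_simps)

lemma total_distance_replace_port_by_ballast:
  "total_distance (replace_port_by_ballast d y) = total_distance y + d"
  by (simp add: total_distance_def replace_port_by_ballast_def)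

text \<open>Clearing the positive denominator leaves an inequality linear in \<open>d\<close>. The
  last assumption makes its slope positive, so dividing by it keeps the direction.\<close>

lemma compliant_replace_port_by_ballast_iff:
  assumes "0 < capacity s" "0 < total_distance y + d"
    and "ballast_rate s (ballast_speed y) - port_rate s / ballast_speed y < capacity s * std"
  shows "compliant s std (replace_port_by_ballast d y) \<longleftrightarrow> break_even_distance s std y \<le> d"
proof -
  define r where "r = ballast_rate s (ballast_speed y) - port_rate s / ballast_speed y"
  have "compliant s std (replace_port_by_ballast d y) \<longleftrightarrow>
      emissions s y + d * r \<le> std * (capacity s * (total_distance y + d))"
    using assms(1,2)
    by (simp add: compliant_def CII_def emissions_replace_port_by_ballast
        total_distance_replace_port_by_ballast pos_divide_le_eq flip: r_def)
  also have "\<dots> \<longleftrightarrow> emissions s y - capacity s * std * total_distance y \<le> d * (capacity s * std - r)"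
    by (simp add: algebra_simps)
  also have "\<dots> \<longleftrightarrow> break_even_distance s std y \<le> d"
    using assms(3) by (simp add: break_even_distance_def pos_divide_le_eq flip: r_def)
  finally show ?thesis .
qed

theorem proposition1:
  fixes s :: ship and y :: operation and e CII\<^sub>0 CII_target p :: real
  assumes ship: "0 < capacity s" "0 < e"
    and year: "0 \<le> laden_distance y" "0 \<le> ballast_distance y" "0 < total_distance y"
      "0 \<le> port_time y"
    and A1: "ballast_rate s e < laden_rate s e" "0 < ballast_rate s e" "0 \<le> port_rate s"
    and A2: "port_rate s / e < ballast_rate s e"
    and A3: "e \<in> speeds s" "\<forall>v\<in>speeds s. e \<le> v" "laden_speed y = e" "ballast_speed y = e"
    and initially_compliant: "compliant s CII\<^sub>0 y"
    and tightened: "0 < p" "p < 1" "CII_target = (1 - p) * CII\<^sub>0"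
    and A4: "ballast_rate s e \<le> capacity s * CII_target"
    and nondegenerate: "0 < port_rate s \<or> ballast_rate s e < capacity s * CII_target"
  shows "(\<exists>d>0. compliant s CII_target (replace_port_by_ballast d y) \<and>
              (enough_port_time s CII_target y \<longrightarrow>
                 0 \<le> port_time (replace_port_by_ballast d y))) \<and>
         (\<forall>d>0. emissions s y < emissions s (replace_port_by_ballast d y))"
proof (intro conjI allI impI)
  define b where "b = break_even_distance s CII_target y"
  \<comment> \<open>If port time suffices, all of it is converted, leaving exactly zero; this covers
    \<open>b\<close> by \<open>enough_port_time\<close>. Otherwise only \<open>b \<le> d\<close>
    matters, and the 1 keeps \<open>d\<close> positive when \<open>b\<close> is not.\<close>
  define d where "d = (if enough_port_time s CII_target y then e * port_time y else max 1 b)"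
  have "0 < d" and "b \<le> d"
    using ship(2) A3(4)
    by (auto simp: d_def b_def enough_port_time_def pos_divide_le_eq mult.commute)
  have "0 \<le> port_rate s / e" "0 < port_rate s \<Longrightarrow> 0 < port_rate s / e"
    using A1(3) ship(2) by simp_all
  \<comment> \<open>A4 alone gives only a weak inequality when port emissions vanish. With equality
    here, the sign of the excess over the target would not depend on \<open>d\<close>, so a ship
    above the target could never reach it; \<open>nondegenerate\<close> excludes this.\<close>
  then have "ballast_rate s e - port_rate s / e < capacity s * CII_target"
    using A4 nondegenerate by linarith
  then have "compliant s CII_target (replace_port_by_ballast d y)"
    using compliant_replace_port_by_ballast_iff[of s y d CII_target] ship(1) year(3)
      \<open>0 < d\<close> \<open>b \<le> d\<close> A3(4) by (simp add: b_def)
  moreover have "0 \<le> port_time (replace_port_by_ballast d y)" if "enough_port_time s CII_target y"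
    using that ship(2) A3(4) by (simp add: d_def replace_port_by_ballast_def)
  ultimately show "\<exists>d>0. compliant s CII_target (replace_port_by_ballast d y) \<and>
      (enough_port_time s CII_target y \<longrightarrow> 0 \<le> port_time (replace_port_by_ballast d y))"
    using \<open>0 < d\<close> by blast
next
  fix d :: real
  assume "0 < d"
  then show "emissions s y < emissions s (replace_port_by_ballast d y)"
    using A2 A3(4) by (simp add: emissions_replace_port_by_ballast)
qed

end
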